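(* Let $n\ge 1$ be an integer, $\kappa>0$, let $C\subset\mathbb{H}^n_\kappa$ be a closed $\kappa$-hyperbolically convex set and $f:\mathbb{H}^n_\kappa\to\mathbb{R}$ a differentiable function such that the problem of minimizing $f$ over $C$ has a nonempty solution set, with optimum value $f^*:=\inf_{p\in C}f(p)>-\infty$. Assume that $\operatorname{grad} f$ is Lipschitz continuous on $C$ with constant $L\ge 0$, let $0<\alpha<1/L$ (with $1/L:=+\infty$ if $L=0$), and set $\Gamma:=(1-\alpha L)/(2\alpha)>0$. Let $p_0\in C$ and let $(p_k)_{k\in\mathbb{N}}$ be defined by $$p_{k+1}:=P^\kappa_C\big(\exp^\kappa_{p_k}(-\alpha\operatorname{grad} f(p_k))\big),\qquad k=0,1,\dots,$$ and assume $\operatorname{grad} f(p_k)\ne 0$ for all $k$. Then for all $N\in\mathbb{N}$, $$\min\{d_\kappa(p_k,p_{k+1}):k=0,1,\dots,N\}\le\frac{\sqrt{f(p_0)-f^*}}{\sqrt{\Gamma(N+1)}}.$$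
   Context: For $x,y\in\mathbb{R}^{n+1}$ the Lorentzian inner product is $\langle x,y\rangle:=x_1y_1+\dots+x_ny_n-x_{n+1}y_{n+1}$. The $\kappa$-hyperbolic space form is $\mathbb{H}^n_\kappa:=\{p\in\mathbb{R}^{n+1}:\langle p,p\rangle=-1/\kappa,\ p_{n+1}>0\}$, with tangent space $T_p\mathbb{H}^n_\kappa:=\{v\in\mathbb{R}^{n+1}:\langle p,v\rangle=0\}$, on which $\langle\cdot,\cdot\rangle$ is positive definite (a Riemannian metric), with norm $\|v\|=\sqrt{\langle v,v\rangle}$. The intrinsic distance is $d_\kappa(p,q):=\frac{1}{\sqrt\kappa}\operatorname{arcosh}(-\kappa\langle p,q\rangle)$. Exponential map: $\exp^\kappa_p(0)=p$ and $\exp^\kappa_p(v)=\cosh(\sqrt\kappa\|v\|)\,p+\sinh(\sqrt\kappa\|v\|)\frac{v}{\sqrt\kappa\|v\|}$ for $0\ne v\in T_p\mathbb{H}^n_\kappa$. Its inverse is $\log^\kappa_p p=0$ and $\log^\kappa_p q=d_\kappa(p,q)\frac{q+\kappa\langle p,q\rangle p}{\|q+\kappa\langle p,q\rangle p\|}$ for $q\ne p$. The geodesic segment joining $p$ to $q$ is $\{\exp^\kappa_p(t\log^\kappa_p q):t\in[0,1]\}$. A set $C\subseteq\mathbb{H}^n_\kappa$ is $\kappa$-hyperbolically convex if for all $p,q\in C$ the geodesic segment joining $p$ to $q$ is contained in $C$. For a nonempty closed $\kappa$-hyperbolically convex set $C$, the intrinsic $\kappa$-projection $P^\kappa_C(p)$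 of $p\in\mathbb{H}^n_\kappa$ is the unique minimizer of $q\mapsto d_\kappa(p,q)$ over $q\in C$. $\operatorname{grad} f(p)\in T_p\mathbb{H}^n_\kappa$ is the Riemannian gradient: $df(p)v=\langle\operatorname{grad} f(p),v\rangle$ for all $v\in T_p\mathbb{H}^n_\kappa$. Parallel transport $P_{pq}:T_p\mathbb{H}^n_\kappa\to T_q\mathbb{H}^n_\kappa$ is $P_{pq}(v)=v-\frac{\kappa\langle q,v\rangle}{\kappa\langle p,q\rangle-1}(p+q)$. $\operatorname{grad} f$ is Lipschitz continuous on $C$ with constant $L$ if $\|P_{pq}\operatorname{grad} f(p)-\operatorname{grad} f(q)\|\le L\,d_\kappa(p,q)$ for all $p,q\in C$. *)

theory Defs
  imports "HOL-Analysis.Analysis"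
begin

text \<open>
  The ambient space $R^{n+1}$ is the product type \<open>(real ^ 'n) \<times> real\<close>: the first component holds
  the coordinates $x_1,\dots,x_n$ with $n$ = \<open>CARD('n)\<close>, the second one the coordinate $x_{n+1}$.
\<close>

type_synonym 'n lorentz = "(real ^ 'n) \<times> real"

definition lor :: "'n::finite lorentz \<Rightarrow> 'n lorentz \<Rightarrow> real" where
  "lor x y = (\<Sum>i\<in>UNIV. fst x $ i * fst y $ i) - snd x * snd y"

definition lnorm :: "'n::finite lorentz \<Rightarrow> real" where
  "lnorm v = sqrt (lor v v)"

definition hyp :: "real \<Rightarrow> 'n::finite lorentz set" where
  "hyp \<kappa> = {p. lor p p = - 1 / \<kappa> \<and> snd p > 0}"

definition tangent :: "'n::finite lorentz \<Rightarrow> 'n lorentz set" where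
  "tangent p = {v. lor p v = 0}"

definition hdist :: "real \<Rightarrow> 'n::finite lorentz \<Rightarrow> 'n lorentz \<Rightarrow> real" where
  "hdist \<kappa> p q = 1 / sqrt \<kappa> * arcosh (- \<kappa> * lor p q)"

definition hexp :: "real \<Rightarrow> 'n::finite lorentz \<Rightarrow> 'n lorentz \<Rightarrow> 'n lorentz" where
  "hexp \<kappa> p v =
    (if v = 0 then p
     else cosh (sqrt \<kappa> * lnorm v) *\<^sub>R p
        + (sinh (sqrt \<kappa> * lnorm v) / (sqrt \<kappa> * lnorm v)) *\<^sub>R v)"

definition hlog :: "real \<Rightarrow> 'n::finite lorentz \<Rightarrow> 'n lorentz \<Rightarrow> 'n lorentz" where
  "hlog \<kappa> p q =
    (if q = p then 0
     else (hdist \<kappa> p q / lnorm (q + (\<kappa> * lor p q) *\<^sub>R p)) *\<^sub>R (q + (\<kappa> * lor p q) *\<^sub>R p))"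

definition hsegment :: "real \<Rightarrow> 'n::finite lorentz \<Rightarrow> 'n lorentz \<Rightarrow> 'n lorentz set" where
  "hsegment \<kappa> p q = {hexp \<kappa> p (t *\<^sub>R hlog \<kappa> p q) |t. t \<in> {0..1}}"

definition hconvex :: "real \<Rightarrow> 'n::finite lorentz set \<Rightarrow> bool" where
  "hconvex \<kappa> C \<longleftrightarrow> C \<subseteq> hyp \<kappa> \<and> (\<forall>p\<in>C. \<forall>q\<in>C. hsegment \<kappa> p q \<subseteq> C)"

text \<open>Meaningful for nonempty closed convex \<open>C\<close>, where the minimizer exists and is unique.\<close>

definition hproj :: "real \<Rightarrow> 'n::finite lorentz set \<Rightarrow> 'n lorentz \<Rightarrow> 'n lorentz" where
  "hproj \<kappa> C p = (THE q. q \<in> C \<and> (\<forall>r\<in>C. hdist \<kappa> p q \<le> hdist \<kappa> p r))"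

text \<open>
  A function on the space form is a function on the ambient space of which only the values on
  \<open>hyp \<kappa>\<close> are used. Since \<open>hyp \<kappa>\<close> is an embedded submanifold, differentiability on it is
  differentiability within the set \<open>hyp \<kappa>\<close>, and the differential at \<open>p\<close> is the restriction to
  \<open>tangent p\<close> of any Frechet derivative within \<open>hyp \<kappa>\<close>. Such a derivative is not unique on the
  ambient space, but its restriction to the tangent space is, by lemma \<open>tangent_derivative_unique\<close>.
  Lemma \<open>hgrad\<close> then shows that the gradient exists and represents that differential.
\<close>

definition hgrad :: "real \<Rightarrow> ('n::finite lorentz \<Rightarrow> real) \<Rightarrow> 'n lorentz \<Rightarrow> 'n lorentz" where
  "hgrad \<kappa> f p =
    (THE g. g \<in> tangent p \<and>
       (\<forall>v\<in>tangent p. frechet_derivative f (at p within hyp \<kappa>) v = lor g v))"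

definition ptransport :: "real \<Rightarrow> 'n::finite lorentz \<Rightarrow> 'n lorentz \<Rightarrow> 'n lorentz \<Rightarrow> 'n lorentz" where
  "ptransport \<kappa> p q v = v - (\<kappa> * lor q v / (\<kappa> * lor p q - 1)) *\<^sub>R (p + q)"

definition hgrad_lipschitz_on ::
  "real \<Rightarrow> real \<Rightarrow> 'n::finite lorentz set \<Rightarrow> ('n lorentz \<Rightarrow> real) \<Rightarrow> bool" where
  "hgrad_lipschitz_on \<kappa> L C f \<longleftrightarrow>
    (\<forall>p\<in>C. \<forall>q\<in>C. lnorm (ptransport \<kappa> p q (hgrad \<kappa> f p) - hgrad \<kappa> f q) \<le> L * hdist \<kappa> p q)"


subsection \<open>Well-definedness of the gradient\<close>

lemma lor_inner: "lor x y = fst x \<bullet> fst y - snd x * snd y"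
  by (simp add: lor_def inner_vec_def)

lemma lor_add_left: "lor (x + y) z = lor x z + lor y z"
  and lor_diff_left: "lor (x - y) z = lor x z - lor y z"
  and lor_scale_left: "lor (c *\<^sub>R x) z = c * lor x z"
  and lor_commute: "lor x z = lor z x"
  by (simp_all add: lor_inner inner_add_left inner_diff_left algebra_simps inner_commute)

lemma lor_tangent_pos:
  assumes "\<kappa> > 0" "p \<in> hyp \<kappa>" "v \<in> tangent p" "v \<noteq> 0"
  shows "lor v v > 0"
proof -
  obtain x a u b where eq: "p = (x, a)" "v = (u, b)" by (metis surj_pair)
  from assms have a: "a > 0" "x \<bullet> x = a\<^sup>2 - 1 / \<kappa>" and xu: "x \<bullet> u = a * b"
    by (auto simp: eq hyp_def tangent_def lor_inner power2_eq_square)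
  have "(a * b)\<^sup>2 \<le> (x \<bullet> x) * (u \<bullet> u)"
    using Cauchy_Schwarz_ineq[of x u] xu by simp
  also have "\<dots> = a\<^sup>2 * (u \<bullet> u) - (u \<bullet> u) / \<kappa>"
    by (simp add: a algebra_simps)
  finally have *: "a\<^sup>2 * b\<^sup>2 \<le> a\<^sup>2 * (u \<bullet> u) - (u \<bullet> u) / \<kappa>"
    by (simp add: power_mult_distrib)
  have "u \<noteq> 0"
  proof
    assume "u = 0"
    with xu a have "b = 0" by simp
    with \<open>u = 0\<close> assms(4) show False by (simp add: eq zero_prod_def)
  qed
  then have "(u \<bullet> u) / \<kappa> > 0" using assms(1) by simp
  with * have "a\<^sup>2 * b\<^sup>2 < a\<^sup>2 * (u \<bullet> u)" by linarith
  then have "b\<^sup>2 < u \<bullet> u" using a(1) by simp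
  then show ?thesis by (simp add: eq lor_inner power2_eq_square)
qed

lemma tangent_derivative_unique:
  fixes f :: "'n::finite lorentz \<Rightarrow> real"
  assumes \<kappa>: "\<kappa> > 0" and p: "p \<in> hyp \<kappa>" and v: "v \<in> tangent p"
    and D: "(f has_derivative D) (at p within hyp \<kappa>)"
    and E: "(f has_derivative E) (at p within hyp \<kappa>)"
  shows "D v = E v"
proof -
  obtain x a u b where eq: "p = (x, a)" "v = (u, b)" by (metis surj_pair)
  from p v have a: "a > 0" "1 / \<kappa> + x \<bullet> x = a\<^sup>2" and xu: "x \<bullet> u = a * b"
    by (auto simp: eq hyp_def tangent_def lor_inner power2_eq_square)
  define c where "c t = (x + t *\<^sub>R u, sqrt (1 / \<kappa> + (x + t *\<^sub>R u) \<bullet> (x + t *\<^sub>R u)))" for t :: real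
  have pos: "1 / \<kappa> + y \<bullet> y > 0" for y :: "real ^ 'n"
    using \<kappa> by (simp add: add_pos_nonneg)
  have c_hyp: "c t \<in> hyp \<kappa>" for t
    using pos[of "x + t *\<^sub>R u"] less_imp_le[OF pos[of "x + t *\<^sub>R u"]]
    by (simp add: hyp_def c_def lor_inner)
  have c0: "c 0 = p" using a by (simp add: c_def eq)
  have "(c has_derivative (\<lambda>t. t *\<^sub>R v)) (at 0)"
    unfolding c_def eq using a pos[of x]
    by (auto intro!: derivative_eq_intros simp: xu inner_commute[of u x] fun_eq_iff)
  then have c': "(c has_derivative (\<lambda>t. t *\<^sub>R v)) (at 0 within UNIV)" by simp
  have comp: "((\<lambda>t. f (c t)) has_derivative (\<lambda>t. F (t *\<^sub>R v))) (at 0)"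
    if "(f has_derivative F) (at p within hyp \<kappa>)" for F
  proof -
    have "(f has_derivative F) (at (c 0) within range c)"
      using has_derivative_subset[OF that, of "range c"] c_hyp c0 by auto
    from has_derivative_in_compose[OF c' this] show ?thesis by simp
  qed
  have "(\<lambda>t. D (t *\<^sub>R v)) = (\<lambda>t. E (t *\<^sub>R v))"
    using comp[OF D] comp[OF E] by (rule has_derivative_unique)
  from fun_cong[OF this, of 1] show ?thesis by simp
qed

lemma hgrad:
  fixes f :: "'n::finite lorentz \<Rightarrow> real"
  assumes \<kappa>: "\<kappa> > 0" and p: "p \<in> hyp \<kappa>"
    and D: "(f has_derivative D) (at p within hyp \<kappa>)"
  shows "hgrad \<kappa> f p \<in> tangent p" and "v \<in> tangent p \<Longrightarrow> D v = lor (hgrad \<kappa> f p) v"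
proof -
  define F where "F = frechet_derivative f (at p within hyp \<kappa>)"
  have F: "(f has_derivative F) (at p within hyp \<kappa>)"
    unfolding F_def using D by (metis differentiableI frechet_derivative_works)
  interpret F: linear F using F by (rule has_derivative_linear)
  define w where "w = adjoint F 1"
  have w: "F v = w \<bullet> v" for v
    using adjoint_works[OF F.linear_axioms, of v 1] by (simp add: w_def inner_commute)
  define j where "j = (fst w, - snd w)"
  have j: "F v = lor j v" for v
    by (simp add: w j_def lor_inner inner_prod_def)
  define g where "g = j + (\<kappa> * lor j p) *\<^sub>R p"
  have pp: "lor p p = - 1 / \<kappa>" using p by (simp add: hyp_def)
  have tan: "v \<in> tangent p \<longleftrightarrow> lor v p = 0" for v
    unfolding tangent_def using lor_commute[of v p] by simp
  have g: "g \<in> tangent p"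
    using \<kappa> pp by (simp add: tan g_def lor_add_left lor_scale_left)
  have gv: "F v = lor g v" if "v \<in> tangent p" for v
    using that by (simp add: tangent_def g_def lor_add_left lor_scale_left j)
  have "\<exists>!g. g \<in> tangent p \<and> (\<forall>v\<in>tangent p. F v = lor g v)"
  proof (rule ex1I[of _ g])
    show "g \<in> tangent p \<and> (\<forall>v\<in>tangent p. F v = lor g v)" using g gv by blast
  next
    fix h assume h: "h \<in> tangent p \<and> (\<forall>v\<in>tangent p. F v = lor h v)"
    then have t: "h - g \<in> tangent p"
      using g by (simp add: tan lor_diff_left)
    have "lor (h - g) (h - g) = 0"
      using h gv[OF t] t by (auto simp: lor_diff_left[of h g "h - g"])
    then show "h = g" using lor_tangent_pos[OF \<kappa> p t] by force
  qed
  from theI'[OF this] have *: "hgrad \<kappa> f p \<in> tangent p"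
    "\<forall>v\<in>tangent p. F v = lor (hgrad \<kappa> f p) v"
    unfolding hgrad_def F_def[symmetric] by blast+
  show "hgrad \<kappa> f p \<in> tangent p" by (rule *)
  show "D v = lor (hgrad \<kappa> f p) v" if "v \<in> tangent p"
    using bspec[OF *(2) that] tangent_derivative_unique[OF \<kappa> p that D F] by (rule trans[rotated])
qed

end

theory Submission
  imports Defs
begin

text \<open>
  Put $z_k = \exp_{p_k}(-\alpha \, \mathrm{grad} f(p_k))$, so that $p_{k+1}$ is the point of $C$ closest to
  $z_k$. Since $p_k \in C$, we have $d(z_k, p_{k+1}) \le d(z_k, p_k)$; by the hyperbolic law of cosines and
  the monotonicity of $x \coth x$ this implies the Euclidean-looking estimate
  $\langle \mathrm{grad} f(p_k), \log_{p_k} p_{k+1} \rangle \le - d(p_k, p_{k+1})^2 / (2\alpha)$.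
  Parallel transport along a geodesic carries initial to current velocity and preserves inner products, so
  the Lipschitz condition gives the descent inequality
  $f(p_{k+1}) \le f(p_k) + \langle \mathrm{grad} f(p_k), \log_{p_k} p_{k+1} \rangle + (L/2) d(p_k, p_{k+1})^2$.
  Together, $\Gamma d(p_k, p_{k+1})^2 \le f(p_k) - f(p_{k+1})$, which telescopes.
\<close>

section \<open>Lorentzian algebra and comparison of distances on the hyperboloid\<close>

lemma lor_add_right: "lor x (y + z) = lor x y + lor x z"
  and lor_diff_right: "lor x (y - z) = lor x y - lor x z"
  and lor_scale_right: "lor x (c *\<^sub>R y) = c * lor x y"
  and lor_minus_right: "lor x (- y) = - lor x y"
  and lor_minus_left: "lor (- x) y = - lor x y"
  and lor_zero_right: "lor x 0 = 0"
  by (simp_all add: lor_inner inner_add_right inner_diff_right algebra_simps)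

lemmas lor_bilinear = lor_add_left lor_diff_left lor_scale_left lor_minus_left
  lor_add_right lor_diff_right lor_scale_right lor_minus_right lor_zero_right

lemma hyp_lor_self: "p \<in> hyp \<kappa> \<Longrightarrow> lor p p = - 1 / \<kappa>"
  by (simp add: hyp_def)

lemma tangent_diff: "v \<in> tangent p \<Longrightarrow> w \<in> tangent p \<Longrightarrow> v - w \<in> tangent p"
  and tangent_scale: "v \<in> tangent p \<Longrightarrow> c *\<^sub>R v \<in> tangent p"
  by (simp_all add: tangent_def lor_bilinear)

lemma lor_tangent_nonneg:
  assumes "\<kappa> > 0" "p \<in> hyp \<kappa>" "v \<in> tangent p"
  shows "lor v v \<ge> 0"
  using lor_tangent_pos[OF assms] by (cases "v = 0") (auto simp: lor_zero_right)

lemma lnorm_scale: "lnorm (c *\<^sub>R v) = \<bar>c\<bar> * lnorm v"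
  by (simp add: lnorm_def lor_bilinear real_sqrt_mult flip: mult.assoc)

lemma lnorm_unit: "lor u u = 1 \<Longrightarrow> lnorm u = 1"
  by (simp add: lnorm_def)

text \<open>Cauchy-Schwarz holds for the indefinite form because both vectors lie in one tangent
  space, where the form is positive definite.\<close>

lemma lor_le_lnorm_mult:
  assumes "\<kappa> > 0" "p \<in> hyp \<kappa>" "v \<in> tangent p" "w \<in> tangent p"
  shows "lor v w \<le> lnorm v * lnorm w"
proof (cases "w = 0")
  case False
  then have w: "lor w w > 0" using lor_tangent_pos assms by blast
  \<comment> \<open>The coefficient of the orthogonal projection of v onto w; the remainder has
    nonnegative square.\<close>
  define c where "c = lor v w / lor w w"
  have "0 \<le> lor (v - c *\<^sub>R w) (v - c *\<^sub>R w)"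
    using assms by (intro lor_tangent_nonneg[of \<kappa> p] tangent_diff tangent_scale)
  also have "\<dots> = lor v v - (lor v w)\<^sup>2 / lor w w"
    using w by (simp add: lor_bilinear c_def lor_commute[of w v] power2_eq_square field_simps)
  finally have "(lor v w)\<^sup>2 \<le> lor v v * lor w w"
    using w by (simp add: field_simps)
  then show ?thesis
    unfolding lnorm_def real_sqrt_mult[symmetric] by (rule real_le_rsqrt)
qed (simp add: lor_zero_right lnorm_def)

lemma hyp_norm_fst_less:
  assumes "\<kappa> > 0" "p \<in> hyp \<kappa>"
  shows "norm (fst p) < snd p"
proof -
  have "fst p \<bullet> fst p - snd p * snd p < 0" and pos: "snd p > 0"
    using assms by (auto simp: hyp_def lor_inner)
  then have "(norm (fst p))\<^sup>2 < (snd p)\<^sup>2"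
    unfolding power2_norm_eq_inner by (simp add: power2_eq_square)
  from power2_less_imp_less[OF this] pos show ?thesis by simp
qed

text \<open>The factor \<open>snd p - norm (fst p)\<close> is positive, so besides giving the sign
  of \<open>lor p q\<close> this bounds \<open>snd q\<close> as soon as \<open>lor p q\<close> is
  bounded below. That yields compactness in \<open>ex_hproj\<close>.\<close>

lemma lor_hyp_upper:
  assumes "\<kappa> > 0" "p \<in> hyp \<kappa>" "q \<in> hyp \<kappa>"
  shows "lor p q \<le> - ((snd p - norm (fst p)) * snd q)"
proof -
  have "fst p \<bullet> fst q \<le> norm (fst p) * norm (fst q)" by (rule norm_cauchy_schwarz)
  also have "\<dots> \<le> norm (fst p) * snd q"
    using hyp_norm_fst_less[OF assms(1,3)] by (intro mult_left_mono) auto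
  finally show ?thesis by (simp add: lor_inner algebra_simps)
qed

lemma lor_hyp_neg:
  assumes "\<kappa> > 0" "p \<in> hyp \<kappa>" "q \<in> hyp \<kappa>"
  shows "lor p q < 0"
proof -
  have "0 < (snd p - norm (fst p)) * snd q"
    using hyp_norm_fst_less[OF assms(1,2)] assms(3) by (simp add: hyp_def)
  with lor_hyp_upper[OF assms] show ?thesis by linarith
qed

text \<open>Reverse Cauchy-Schwarz inequality. It places the argument of \<open>arcosh\<close> in
  \<open>hdist\<close> in the domain where \<open>arcosh\<close> inverts
  \<open>cosh\<close>.\<close>

lemma lor_hyp_gt_1:
  assumes \<kappa>: "\<kappa> > 0" and p: "p \<in> hyp \<kappa>" and q: "q \<in> hyp \<kappa>" and ne: "p \<noteq> q"
  shows "- \<kappa> * lor p q > 1"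
proof -
  define s where "s = - \<kappa> * lor p q"
  \<comment> \<open>The component of q orthogonal to p. Its square (s*s - 1) / \<kappa> is positive
    unless w = 0, and w = 0 would force s = 1 and q = p.\<close>
  define w where "w = q - s *\<^sub>R p"
  have s: "s > 0" unfolding s_def using lor_hyp_neg[OF \<kappa> p q] \<kappa> by (simp add: mult_pos_neg)
  have pq: "lor p q = - s / \<kappa>" using \<kappa> by (simp add: s_def)
  have wt: "w \<in> tangent p"
    using \<kappa> by (simp add: tangent_def w_def lor_bilinear hyp_lor_self[OF p] pq)
  have ww: "lor w w = (s\<^sup>2 - 1) / \<kappa>"
    using \<kappa> by (simp add: w_def lor_bilinear hyp_lor_self[OF p] hyp_lor_self[OF q] pq
        lor_commute[of q p] power2_eq_square field_simps)
  have "w \<noteq> 0"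
  proof
    assume "w = 0"
    then have "s\<^sup>2 = 1" using ww \<kappa> by (simp add: lor_zero_right)
    then have "s = 1" using s by (simp add: power2_eq_1_iff)
    then show False using \<open>w = 0\<close> ne by (simp add: w_def)
  qed
  then have "(s\<^sup>2 - 1) / \<kappa> > 0" using lor_tangent_pos[OF \<kappa> p wt] ww by simp
  then have "1\<^sup>2 < s\<^sup>2" using \<kappa> by (simp add: zero_less_divide_iff)
  from power2_less_imp_less[OF this] s have "1 < s" by simp
  then show ?thesis by (simp add: s_def)
qed

lemma lor_hyp_ge_1:
  assumes "\<kappa> > 0" "p \<in> hyp \<kappa>" "q \<in> hyp \<kappa>"
  shows "- \<kappa> * lor p q \<ge> 1"
  using lor_hyp_gt_1[OF assms] hyp_lor_self[OF assms(2)] assms(1) by (cases "p = q") auto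

lemma arcosh_le_iff_real:
  fixes x y :: real
  assumes "1 \<le> x" "1 \<le> y"
  shows "arcosh x \<le> arcosh y \<longleftrightarrow> x \<le> y"
  using arcosh_less_iff_real[OF assms(2,1)] by (simp add: linorder_not_less[symmetric])

text \<open>Since \<open>arcosh\<close> increases, comparing distances from z amounts to comparing
  values of the linear functional \<open>lor z\<close>, in reversed order.\<close>

lemma hdist_le_iff:
  assumes "\<kappa> > 0" "z \<in> hyp \<kappa>" "q \<in> hyp \<kappa>" "r \<in> hyp \<kappa>"
  shows "hdist \<kappa> z q \<le> hdist \<kappa> z r \<longleftrightarrow> lor z r \<le> lor z q"
proof -
  have "hdist \<kappa> z q \<le> hdist \<kappa> z r \<longleftrightarrow> arcosh (- \<kappa> * lor z q) \<le> arcosh (- \<kappa> * lor z r)"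
    using assms(1) unfolding hdist_def by (simp add: divide_le_cancel)
  also have "\<dots> \<longleftrightarrow> - \<kappa> * lor z q \<le> - \<kappa> * lor z r"
    using lor_hyp_ge_1[OF assms(1,2,3)] lor_hyp_ge_1[OF assms(1,2,4)]
    by (rule arcosh_le_iff_real)
  finally show ?thesis using assms(1) by simp
qed


subsection \<open>Geodesics\<close>

text \<open>
  The geodesic with initial direction \<open>u\<close>; for a unit tangent vector \<open>u\<close> the parameter is
  \<open>sqrt \<kappa>\<close> times the arc length.
\<close>

definition hray :: "real \<Rightarrow> 'n::finite lorentz \<Rightarrow> 'n lorentz \<Rightarrow> real \<Rightarrow> 'n lorentz" where
  "hray \<kappa> p u s = cosh s *\<^sub>R p + (sinh s / sqrt \<kappa>) *\<^sub>R u"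

lemma lor_hray_base:
  assumes "p \<in> hyp \<kappa>" "u \<in> tangent p"
  shows "lor p (hray \<kappa> p u s) = - cosh s / \<kappa>"
  using assms by (simp add: hray_def lor_bilinear hyp_lor_self tangent_def)

lemma lor_hray_hray:
  assumes "\<kappa> > 0" "p \<in> hyp \<kappa>" "u \<in> tangent p" "w \<in> tangent p"
  shows "lor (hray \<kappa> p u s) (hray \<kappa> p w t) = (sinh s * sinh t * lor u w - cosh s * cosh t) / \<kappa>"
  using assms by (simp add: hray_def lor_bilinear hyp_lor_self tangent_def lor_commute[of u p]
      field_simps)

lemma hray_in_hyp:
  assumes \<kappa>: "\<kappa> > 0" and p: "p \<in> hyp \<kappa>" and u: "u \<in> tangent p" "lor u u = 1"
  shows "hray \<kappa> p u s \<in> hyp \<kappa>"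
proof -
  define z where "z = hray \<kappa> p u s"
  have zz: "lor z z = - 1 / \<kappa>"
    using cosh_square_eq[of s] unfolding z_def lor_hray_hray[OF \<kappa> p u(1) u(1)] u(2)
    by (simp add: power2_eq_square)
  have pz: "lor p z < 0"
    using \<kappa> cosh_real_pos[of s] unfolding z_def lor_hray_base[OF p u(1)] by simp
  \<comment> \<open>The quadratic equation allows two sheets. On the lower one \<open>- z\<close>
    would lie in \<open>hyp \<kappa>\<close>, which contradicts the sign of
    \<open>lor p z\<close>.\<close>
  have "snd z > 0"
  proof (rule ccontr)
    assume "\<not> snd z > 0"
    moreover have "snd z \<noteq> 0"
    proof
      assume "snd z = 0"
      then have "fst z \<bullet> fst z = - 1 / \<kappa>" using zz by (simp add: lor_inner)
      then show False using inner_ge_zero[of "fst z"] \<kappa> divide_neg_pos[of "- 1" \<kappa>] by linarith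
    qed
    ultimately have "- z \<in> hyp \<kappa>" using zz by (simp add: hyp_def lor_bilinear)
    from lor_hyp_neg[OF \<kappa> p this] pz show False by (simp add: lor_bilinear)
  qed
  with zz show ?thesis by (simp add: z_def hyp_def)
qed

text \<open>Geodesic polar coordinates around p: s is \<open>sqrt \<kappa>\<close> times the
  distance, and u is the normalized component of q orthogonal to p.\<close>

lemma hyp_polar:
  assumes \<kappa>: "\<kappa> > 0" and p: "p \<in> hyp \<kappa>" and q: "q \<in> hyp \<kappa>" and ne: "p \<noteq> q"
  obtains u s where "u \<in> tangent p" "lor u u = 1" "s > 0" "q = hray \<kappa> p u s"
proof
  define c where "c = - \<kappa> * lor p q"
  define s where "s = arcosh c"
  define u where "u = (sqrt \<kappa> / sinh s) *\<^sub>R (q - c *\<^sub>R p)"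
  have c: "c > 1" unfolding c_def by (rule lor_hyp_gt_1[OF \<kappa> p q ne])
  have cs: "cosh s = c" using c by (simp add: s_def)
  show s: "s > 0" using c by (simp add: s_def arcosh_real_gt_1_iff)
  have sh: "sinh s > 0" using s by simp
  have pq: "lor p q = - c / \<kappa>" using \<kappa> by (simp add: c_def)
  show "u \<in> tangent p" unfolding u_def
    using \<kappa> by (intro tangent_scale) (simp add: tangent_def lor_bilinear hyp_lor_self[OF p] pq)
  have "lor (q - c *\<^sub>R p) (q - c *\<^sub>R p) = (c\<^sup>2 - 1) / \<kappa>"
    using \<kappa> by (simp add: lor_bilinear hyp_lor_self[OF p] hyp_lor_self[OF q] pq
        lor_commute[of q p] power2_eq_square field_simps)
  also have "\<dots> = (sinh s)\<^sup>2 / \<kappa>" using cosh_square_eq[of s] by (simp add: cs)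
  finally show "lor u u = 1"
    using \<kappa> sh by (simp add: u_def lor_scale_left lor_scale_right power2_eq_square)
  show "q = hray \<kappa> p u s" using \<kappa> sh by (simp add: hray_def u_def cs)
qed

lemma hdist_hray:
  assumes "\<kappa> > 0" "p \<in> hyp \<kappa>" "u \<in> tangent p" "s \<ge> 0"
  shows "hdist \<kappa> p (hray \<kappa> p u s) = s / sqrt \<kappa>"
  using assms by (simp add: hdist_def lor_hray_base arcosh_cosh_real)

lemma hdist_self: "\<kappa> > 0 \<Longrightarrow> p \<in> hyp \<kappa> \<Longrightarrow> hdist \<kappa> p p = 0"
  by (simp add: hdist_def hyp_lor_self)

lemma hdist_nonneg:
  assumes "\<kappa> > 0" "p \<in> hyp \<kappa>" "q \<in> hyp \<kappa>"
  shows "hdist \<kappa> p q \<ge> 0"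
  using lor_hyp_ge_1[OF assms] assms(1) by (simp add: hdist_def)

lemma hexp_unit:
  assumes "\<kappa> > 0" "lor u u = 1" "a \<ge> 0"
  shows "hexp \<kappa> p (a *\<^sub>R u) = hray \<kappa> p u (sqrt \<kappa> * a)"
proof -
  have "u \<noteq> 0" using assms(2) by (auto simp: lor_zero_right)
  moreover have "lnorm (a *\<^sub>R u) = a" using assms by (simp add: lnorm_scale lnorm_unit)
  ultimately show ?thesis
    using assms by (auto simp: hexp_def hray_def)
qed

lemma tangent_polar:
  assumes "\<kappa> > 0" "p \<in> hyp \<kappa>" "v \<in> tangent p" "v \<noteq> 0"
  obtains w l where "w \<in> tangent p" "lor w w = 1" "l > 0" "v = l *\<^sub>R w"
proof
  define l where "l = lnorm v"
  show l: "l > 0" using lor_tangent_pos[OF assms] by (simp add: l_def lnorm_def)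
  have ll: "l * l = lor v v"
    using lor_tangent_nonneg[OF assms(1-3)] by (simp add: l_def lnorm_def)
  show "(1 / l) *\<^sub>R v \<in> tangent p" by (rule tangent_scale[OF assms(3)])
  show "lor ((1 / l) *\<^sub>R v) ((1 / l) *\<^sub>R v) = 1"
    using l by (simp add: lor_scale_left lor_scale_right flip: ll)
  show "v = l *\<^sub>R (1 / l) *\<^sub>R v" using l by simp
qed

lemma hexp_in_hyp:
  assumes \<kappa>: "\<kappa> > 0" and p: "p \<in> hyp \<kappa>" and v: "v \<in> tangent p"
  shows "hexp \<kappa> p v \<in> hyp \<kappa>"
proof (cases "v = 0")
  case True
  then show ?thesis using p by (simp add: hexp_def)
next
  case False
  obtain w l where w: "w \<in> tangent p" "lor w w = 1" and l: "l > 0" and v_eq: "v = l *\<^sub>R w"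
    using tangent_polar[OF \<kappa> p v False] by blast
  show ?thesis
    using hray_in_hyp[OF \<kappa> p w] hexp_unit[OF \<kappa> w(2)] l by (simp add: v_eq)
qed

lemma hlog_hray:
  assumes \<kappa>: "\<kappa> > 0" and p: "p \<in> hyp \<kappa>" and u: "u \<in> tangent p" "lor u u = 1" and s: "s > 0"
  shows "hlog \<kappa> p (hray \<kappa> p u s) = (s / sqrt \<kappa>) *\<^sub>R u"
proof -
  have d: "hdist \<kappa> p (hray \<kappa> p u s) = s / sqrt \<kappa>" using hdist_hray \<kappa> p u(1) s by fastforce
  then have ne: "hray \<kappa> p u s \<noteq> p" using hdist_self[OF \<kappa> p] \<kappa> s by auto
  have w: "hray \<kappa> p u s + (\<kappa> * lor p (hray \<kappa> p u s)) *\<^sub>R p = (sinh s / sqrt \<kappa>) *\<^sub>R u"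
    using \<kappa> unfolding lor_hray_base[OF p u(1)] by (simp add: hray_def)
  have "lnorm ((sinh s / sqrt \<kappa>) *\<^sub>R u) = sinh s / sqrt \<kappa>"
    using \<kappa> s u(2) by (simp add: lnorm_scale lnorm_unit)
  then show ?thesis using ne \<kappa> s unfolding hlog_def w d by simp
qed

lemma hray_in_hsegment:
  assumes "\<kappa> > 0" "p \<in> hyp \<kappa>" "u \<in> tangent p" "lor u u = 1" "s > 0" "t \<in> {0..1}"
  shows "hray \<kappa> p u (t * s) \<in> hsegment \<kappa> p (hray \<kappa> p u s)"
proof -
  have "hexp \<kappa> p (t *\<^sub>R hlog \<kappa> p (hray \<kappa> p u s)) = hray \<kappa> p u (sqrt \<kappa> * (t * s / sqrt \<kappa>))"
    unfolding hlog_hray[OF assms(1-5)] using hexp_unit[OF assms(1,4), of "t * s / sqrt \<kappa>"] assms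
    by simp
  then show ?thesis using assms(1,6) unfolding hsegment_def by (auto intro!: exI[of _ t])
qed


subsection \<open>The projection\<close>

text \<open>The strict condition on \<open>snd p\<close> may be weakened to a closed one, because
  \<open>snd p = 0\<close> would make a sum of squares negative.\<close>

lemma closed_hyp:
  assumes "\<kappa> > 0"
  shows "closed (hyp \<kappa> :: 'n::finite lorentz set)"
proof -
  have "hyp \<kappa> = {p :: 'n lorentz. fst p \<bullet> fst p - snd p * snd p = - 1 / \<kappa>} \<inter> {p. 0 \<le> snd p}"
  proof -
    have "snd p > 0" if "fst p \<bullet> fst p - snd p * snd p = - 1 / \<kappa>" "0 \<le> snd p"
      for p :: "'n lorentz"
    proof (rule ccontr)
      assume "\<not> snd p > 0"
      then have "snd p = 0" using that by simp
      then have "fst p \<bullet> fst p = - 1 / \<kappa>" using that by simp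
      then show False using inner_ge_zero[of "fst p"] assms divide_neg_pos[of "- 1" \<kappa>] by linarith
    qed
    then show ?thesis by (auto simp: hyp_def lor_inner)
  qed
  also have "closed \<dots>"
    by (intro closed_Int closed_Collect_eq closed_Collect_le continuous_intros)
  finally show ?thesis .
qed

lemma ex_hproj:
  fixes C :: "'n::finite lorentz set"
  assumes \<kappa>: "\<kappa> > 0" and C: "closed C" "C \<subseteq> hyp \<kappa>" "C \<noteq> {}" and z: "z \<in> hyp \<kappa>"
  shows "\<exists>q\<in>C. \<forall>r\<in>C. hdist \<kappa> z q \<le> hdist \<kappa> z r"
proof -
  obtain c where c: "c \<in> C" using C(3) by blast
  \<comment> \<open>The points of C at most as far from z as c. A maximizer of \<open>lor z\<close>
    on this compact set is a minimizer of the distance on C.\<close>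
  define K where "K = {q \<in> C. lor z c \<le> lor z q}"
  define b where "b = snd z - norm (fst z)"
  have b: "b > 0" using hyp_norm_fst_less[OF \<kappa> z] by (simp add: b_def)
  have cont: "continuous_on A (lor z)" for A
    unfolding lor_inner by (intro continuous_intros)
  have "K = C \<inter> {q. lor z c \<le> lor z q}" unfolding K_def by blast
  also have "closed \<dots>" by (intro closed_Int C(1) closed_Collect_le cont continuous_on_const)
  finally have "closed K" .
  \<comment> \<open>On the hyperboloid \<open>norm (fst q) < snd q\<close>, so a bound on
    \<open>snd q\<close> bounds q.\<close>
  moreover have "norm q \<le> 2 * (- lor z c / b)" if "q \<in> K" for q
  proof -
    from that have q: "q \<in> hyp \<kappa>" "lor z c \<le> lor z q" using C(2) by (auto simp: K_def)
    have "b * snd q \<le> - lor z c" using lor_hyp_upper[OF \<kappa> z q(1)] q(2) by (simp add: b_def)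
    then have "snd q \<le> - lor z c / b" using b by (simp add: field_simps)
    moreover have "norm q \<le> norm (fst q) + norm (snd q)"
      using norm_Pair_le[of "fst q" "snd q"] by simp
    ultimately show ?thesis
      using hyp_norm_fst_less[OF \<kappa> q(1)] norm_ge_zero[of "fst q"] unfolding real_norm_def by linarith
  qed
  then have "bounded K" unfolding bounded_iff by blast
  ultimately have "compact K" by (simp add: compact_eq_bounded_closed)
  moreover have "c \<in> K" using c by (simp add: K_def)
  then have "K \<noteq> {}" by blast
  ultimately have "\<exists>q\<in>K. \<forall>r\<in>K. lor z r \<le> lor z q"
    by (rule continuous_attains_sup[OF _ _ cont])
  then obtain q where q: "q \<in> K" "\<And>r. r \<in> K \<Longrightarrow> lor z r \<le> lor z q"
    by blast
  have qC: "q \<in> C" and cq: "lor z c \<le> lor z q" using q(1) by (simp_all add: K_def)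
  have "lor z r \<le> lor z q" if "r \<in> C" for r
  proof (cases "lor z c \<le> lor z r")
    case True
    with that show ?thesis by (intro q(2)) (simp add: K_def)
  qed (use cq in simp)
  then have "\<forall>r\<in>C. hdist \<kappa> z q \<le> hdist \<kappa> z r"
    using hdist_le_iff[OF \<kappa> z] qC C(2) by blast
  with qC show ?thesis by blast
qed

text \<open>
  The midpoint of two distinct minimizers is their sum divided by a number greater than 2, hence
  would be strictly closer to \<open>z\<close>.
\<close>

lemma hproj_unique:
  assumes \<kappa>: "\<kappa> > 0" and C: "hconvex \<kappa> C" and z: "z \<in> hyp \<kappa>"
    and q: "q \<in> C" "\<forall>r\<in>C. hdist \<kappa> z q \<le> hdist \<kappa> z r"
    and q': "q' \<in> C" "\<forall>r\<in>C. hdist \<kappa> z q' \<le> hdist \<kappa> z r"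
  shows "q = q'"
proof (rule ccontr)
  assume ne: "q \<noteq> q'"
  have sub: "C \<subseteq> hyp \<kappa>" using C by (simp add: hconvex_def)
  then have h: "q \<in> hyp \<kappa>" "q' \<in> hyp \<kappa>" using q q' by auto
  obtain u s where u: "u \<in> tangent q" "lor u u = 1" and s: "s > 0" and q'eq: "q' = hray \<kappa> q u s"
    using hyp_polar[OF \<kappa> h ne] by blast
  define m where "m = hray \<kappa> q u (1 / 2 * s)"
  have "m \<in> hsegment \<kappa> q q'"
    unfolding m_def q'eq by (rule hray_in_hsegment[OF \<kappa> h(1) u s]) simp
  then have mC: "m \<in> C" using C q(1) q'(1) by (auto simp: hconvex_def)
  define c where "c = cosh (s / 2)"
  have c: "c > 1" using s cosh_real_nonneg_less_iff[of 0 "s / 2"] by (simp add: c_def)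
  have ss: "sinh s = 2 * sinh (s / 2) * c" "cosh s = 2 * c\<^sup>2 - 1"
    using sinh_double[of "s / 2"] cosh_double_cosh[of "s / 2"] by (simp_all add: c_def)
  have "(2 * c) *\<^sub>R m = q + q'"
    by (simp add: m_def q'eq hray_def ss c_def algebra_simps power2_eq_square)
  then have "2 * c * lor z m = lor z q + lor z q'"
    using lor_scale_right[of z "2 * c" m] lor_add_right[of z q q'] by simp
  moreover have "lor z q = lor z q'"
    using q(2) q'(2) q(1) q'(1) hdist_le_iff[OF \<kappa> z h(1,2)] hdist_le_iff[OF \<kappa> z h(2,1)]
    by (intro antisym) blast+
  \<comment> \<open>As \<open>lor z m\<close> is negative and c > 1, this puts
    \<open>lor z q\<close> strictly below \<open>lor z m\<close>: the midpoint is closer to z than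
    the minimizer q.\<close>
  ultimately have eq: "c * lor z m = lor z q" by simp
  have "lor z m \<le> lor z q" using q(2) mC sub hdist_le_iff[OF \<kappa> z h(1)] by blast
  moreover have "lor z m < 0" using lor_hyp_neg[OF \<kappa> z] mC sub by blast
  ultimately show False using eq c
    using mult_strict_right_mono_neg[of 1 c "lor z m"] by linarith
qed

lemma hproj:
  fixes C :: "'n::finite lorentz set"
  assumes \<kappa>: "\<kappa> > 0" and cl: "closed C" and C: "hconvex \<kappa> C" and ne: "C \<noteq> {}" and z: "z \<in> hyp \<kappa>"
  shows "hproj \<kappa> C z \<in> C" and "r \<in> C \<Longrightarrow> hdist \<kappa> z (hproj \<kappa> C z) \<le> hdist \<kappa> z r"
proof -
  have "\<exists>!q. q \<in> C \<and> (\<forall>r\<in>C. hdist \<kappa> z q \<le> hdist \<kappa> z r)"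
    using ex_hproj[OF \<kappa> cl _ ne z] hproj_unique[OF \<kappa> C z] C unfolding hconvex_def by blast
  from theI'[OF this] show "hproj \<kappa> C z \<in> C"
    and "r \<in> C \<Longrightarrow> hdist \<kappa> z (hproj \<kappa> C z) \<le> hdist \<kappa> z r"
    unfolding hproj_def by blast+
qed

section \<open>A comparison inequality for hyperbolic triangles and the projection step\<close>

lemma x_le_sinh_mult_cosh:
  fixes x :: real
  assumes "x \<ge> 0"
  shows "x \<le> sinh x * cosh x"
proof -
  have "sinh 0 - 0 \<le> sinh x - x"
    by (rule DERIV_nonneg_imp_nondecreasing[OF assms])
      (auto intro!: derivative_eq_intros exI simp: cosh_real_ge_1)
  then have "x \<le> sinh x" by simp
  also have "\<dots> \<le> sinh x * cosh x"
    using assms cosh_real_ge_1[of x] by (simp add: mult_le_cancel_left1)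
  finally show ?thesis .
qed

lemma x_coth_mono:
  fixes x y :: real
  assumes "0 < x" "x \<le> y"
  shows "x * cosh x / sinh x \<le> y * cosh y / sinh y"
proof (rule DERIV_nonneg_imp_nondecreasing[OF assms(2)])
  fix t assume "x \<le> t" "t \<le> y"
  then have t: "t > 0" using assms by simp
  \<comment> \<open>By cosh^2 - sinh^2 = 1, the numerator in the quotient rule collapses to sinh t *
    cosh t - t.\<close>
  have "((\<lambda>t. t * cosh t / sinh t) has_real_derivative
      (sinh t * cosh t - t) / (sinh t)\<^sup>2) (at t)"
    using t cosh_square_eq[of t]
    by (auto intro!: derivative_eq_intros simp: power2_eq_square field_simps)
  moreover have "(sinh t * cosh t - t) / (sinh t)\<^sup>2 \<ge> 0"
    using x_le_sinh_mult_cosh[of t] t by simp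
  ultimately show "\<exists>d. ((\<lambda>t. t * cosh t / sinh t) has_real_derivative d) (at t) \<and> 0 \<le> d"
    by blast
qed

text \<open>
  By the law of cosines the left-hand side of the last assumption is the hyperbolic cosine of the
  side of a triangle opposite to an angle with cosine \<open>c\<close>; the sides \<open>a\<close> and \<open>b\<close> enclose it.
\<close>

lemma cosine_law_angle_bound:
  fixes a b c :: real
  assumes a: "a > 0" and b: "b > 0" and c: "c \<le> 1"
    and le: "cosh a * cosh b - sinh a * sinh b * c \<le> cosh a"
  shows "b \<le> 2 * a * c"
proof -
  define h where "h = b / 2"
  have h: "h > 0" and b_eq: "b = 2 * h" using b by (simp_all add: h_def)
  have sa: "sinh a > 0" and sh: "sinh h > 0" using a h by simp_all
  have ch: "cosh h > 0" and ca: "cosh a > 0" by simp_all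
  \<comment> \<open>Double-angle formulas with h = b / 2. Cancelling 2 * sinh h then leaves tanh h
    \<le> c * tanh a, written without quotients.\<close>
  have "cosh a * (2 * (sinh h)\<^sup>2) \<le> sinh a * (2 * sinh h * cosh h) * c"
    using le cosh_square_eq[of h] unfolding b_eq cosh_double_cosh sinh_double
    by (simp add: algebra_simps)
  then have "(2 * sinh h) * (cosh a * sinh h) \<le> (2 * sinh h) * (sinh a * cosh h * c)"
    by (simp add: power2_eq_square algebra_simps)
  then have *: "cosh a * sinh h \<le> sinh a * cosh h * c"
    using sh by (simp add: mult_le_cancel_left)
  also have "\<dots> \<le> sinh a * cosh h"
    using sa ch c by (simp add: mult_le_cancel_left1)
  \<comment> \<open>From c \<le> 1 follows h \<le> a, so monotonicity of x coth x applies to h and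
    a. Combined with the sharper bound \<open>*\<close>, which retains c, it gives h \<le> a *
    c.\<close>
  finally have "sinh (h - a) \<le> 0" by (simp add: sinh_diff algebra_simps)
  then have "h \<le> a" by simp
  then have "h * cosh h / sinh h \<le> a * cosh a / sinh a" by (rule x_coth_mono[OF h])
  then have "h * cosh h * sinh a \<le> a * cosh a * sinh h"
    using sa sh by (simp add: divide_simps split: if_splits)
  also have "\<dots> \<le> a * (sinh a * cosh h * c)"
    using mult_left_mono[OF *, of a] a by (simp add: algebra_simps)
  finally have "(cosh h * sinh a) * h \<le> (cosh h * sinh a) * (a * c)"
    by (simp add: algebra_simps)
  then have "h \<le> a * c" using sa ch by (simp add: mult_le_cancel_left)
  then show ?thesis by (simp add: b_eq)
qed

text \<open>For v = - \<alpha> grad f(p) this is the projection estimate, up to the factor relating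
  \<open>log\<close> to the unit vector u. In the triangle with vertices p,
  \<open>hexp \<kappa> p v\<close> and \<open>hray \<kappa> p u s\<close>, the angle at p has cosine
  \<open>lor w u\<close>, and \<open>cosine_law_angle_bound\<close> applies.\<close>

lemma hproj_step:
  assumes \<kappa>: "\<kappa> > 0" and p: "p \<in> hyp \<kappa>" and v: "v \<in> tangent p" "v \<noteq> 0"
    and u: "u \<in> tangent p" "lor u u = 1" and s: "s > 0"
    and le: "hdist \<kappa> (hexp \<kappa> p v) (hray \<kappa> p u s) \<le> hdist \<kappa> (hexp \<kappa> p v) p"
  shows "s / sqrt \<kappa> \<le> 2 * lor v u"
proof -
  obtain w l where w: "w \<in> tangent p" "lor w w = 1" and l: "l > 0" and v_eq: "v = l *\<^sub>R w"
    using tangent_polar[OF \<kappa> p v] by blast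
  define a where "a = sqrt \<kappa> * l"
  have a: "a > 0" using \<kappa> l by (simp add: a_def)
  have z: "hexp \<kappa> p v = hray \<kappa> p w a"
    unfolding v_eq a_def using hexp_unit[OF \<kappa> w(2)] l by simp
  have zh: "hray \<kappa> p w a \<in> hyp \<kappa>" by (rule hray_in_hyp[OF \<kappa> p w])
  have "lor (hray \<kappa> p w a) p \<le> lor (hray \<kappa> p w a) (hray \<kappa> p u s)"
    using le hdist_le_iff[OF \<kappa> zh hray_in_hyp[OF \<kappa> p u] p] unfolding z by blast
  then have "cosh a * cosh s - sinh a * sinh s * lor w u \<le> cosh a"
    using \<kappa> unfolding lor_hray_hray[OF \<kappa> p w(1) u(1)] lor_commute[of _ p] lor_hray_base[OF p w(1)]
    by (simp add: field_simps)
  moreover have "lor w u \<le> 1"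
    using lor_le_lnorm_mult[OF \<kappa> p w(1) u(1)] w u by (simp add: lnorm_unit)
  ultimately have "s \<le> 2 * a * lor w u" using cosine_law_angle_bound[OF a s] by blast
  then show ?thesis
    using \<kappa> by (simp add: a_def v_eq lor_scale_left field_simps)
qed


subsection \<open>Descent along geodesics\<close>

text \<open>The derivative of \<open>hray\<close> in s. For unit u its norm is 1 /
  \<open>sqrt \<kappa>\<close>, as s is \<open>sqrt \<kappa>\<close> times arc length.\<close>

definition hray' :: "real \<Rightarrow> 'n::finite lorentz \<Rightarrow> 'n lorentz \<Rightarrow> real \<Rightarrow> 'n lorentz" where
  "hray' \<kappa> p u s = sinh s *\<^sub>R p + (cosh s / sqrt \<kappa>) *\<^sub>R u"

lemma hray_has_vector_derivative:
  assumes "\<kappa> > 0"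
  shows "(hray \<kappa> p u has_vector_derivative hray' \<kappa> p u s) (at s)"
  unfolding hray_def[abs_def] hray'_def
  using assms by (auto intro!: derivative_eq_intros simp: field_simps)

lemma hray'_tangent:
  assumes "\<kappa> > 0" "p \<in> hyp \<kappa>" "u \<in> tangent p" "lor u u = 1"
  shows "hray' \<kappa> p u s \<in> tangent (hray \<kappa> p u s)"
  using assms by (simp add: hray_def hray'_def lor_bilinear hyp_lor_self tangent_def
      lor_commute[of u p] field_simps)

lemma lnorm_hray':
  assumes "\<kappa> > 0" "p \<in> hyp \<kappa>" "u \<in> tangent p" "lor u u = 1"
  shows "lnorm (hray' \<kappa> p u s) = 1 / sqrt \<kappa>"
proof -
  have "lor (hray' \<kappa> p u s) (hray' \<kappa> p u s) = ((cosh s)\<^sup>2 - (sinh s)\<^sup>2) / \<kappa>"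
    using assms by (simp add: hray'_def lor_bilinear hyp_lor_self tangent_def
      lor_commute[of u p] power2_eq_square field_simps)
  also have "\<dots> = 1 / \<kappa>" by (simp add: cosh_square_eq)
  finally show ?thesis by (simp add: lnorm_def real_sqrt_divide)
qed

lemma ptransport_tangent:
  assumes "\<kappa> > 0" "p \<in> hyp \<kappa>" "q \<in> hyp \<kappa>"
  shows "ptransport \<kappa> p q v \<in> tangent q"
proof -
  define c where "c = \<kappa> * lor p q - 1"
  have c: "c \<noteq> 0" using lor_hyp_ge_1[OF assms] by (simp add: c_def)
  have "lor q (p + q) = c / \<kappa>"
    using assms(1) by (simp add: c_def lor_bilinear hyp_lor_self[OF assms(3)] lor_commute[of q p]
        field_simps)
  then have "lor q (v - (\<kappa> * lor q v / c) *\<^sub>R (p + q)) = 0"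
    using c assms(1) by (simp add: lor_diff_right lor_scale_right)
  then show ?thesis by (simp add: ptransport_def tangent_def c_def)
qed

text \<open>Parallel transport is an isometry taking u to \<open>sqrt \<kappa>\<close> times the
  velocity. The resulting pairing is computed here directly from the explicit formula.\<close>

lemma lor_ptransport_hray':
  assumes \<kappa>: "\<kappa> > 0" and p: "p \<in> hyp \<kappa>" and u: "u \<in> tangent p" "lor u u = 1"
    and v: "v \<in> tangent p"
  shows "lor (ptransport \<kappa> p (hray \<kappa> p u s) v) (hray' \<kappa> p u s) = lor v u / sqrt \<kappa>"
proof -
  define q where "q = hray \<kappa> p u s"
  define e where "e = hray' \<kappa> p u s"
  have pv: "lor p v = 0" and pu: "lor p u = 0" using u v by (simp_all add: tangent_def)
  have qv: "lor q v = sinh s / sqrt \<kappa> * lor v u"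
    by (simp add: q_def hray_def lor_bilinear pv lor_commute[of u v])
  have pe: "lor p e = - sinh s / \<kappa>"
    by (simp add: e_def hray'_def lor_bilinear pu hyp_lor_self[OF p])
  have ve: "lor v e = cosh s / sqrt \<kappa> * lor v u"
    by (simp add: e_def hray'_def lor_bilinear lor_commute[of v p] pv)
  have qe: "lor q e = 0"
    using hray'_tangent[OF \<kappa> p u] by (simp add: q_def e_def tangent_def)
  \<comment> \<open>The denominator in the transport formula is - c. Since sinh^2 s = (cosh s - 1) *
    c, the factor left over is cosh s - (cosh s - 1) = 1.\<close>
  define c where "c = cosh s + 1"
  have pq: "\<kappa> * lor p q - 1 = - c"
    using \<kappa> by (simp add: q_def c_def lor_hray_base[OF p u(1)])
  have c: "c > 0" by (simp add: c_def add_pos_pos)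
  have "lor (ptransport \<kappa> p q v) e = lor v u / sqrt \<kappa> * (cosh s - (sinh s)\<^sup>2 / c)"
    unfolding ptransport_def pq using \<kappa> c
    by (simp add: lor_diff_left lor_scale_left lor_add_left qv pe ve qe power2_eq_square field_simps)
  also have "(sinh s)\<^sup>2 = (cosh s - 1) * c"
    using cosh_square_eq[of s] by (simp add: c_def algebra_simps power2_eq_square)
  also have "cosh s - (cosh s - 1) * c / c = 1" using c by simp
  finally have "lor (ptransport \<kappa> p q v) e = lor v u / sqrt \<kappa>" by simp
  then show ?thesis by (simp add: q_def e_def)
qed

lemma has_derivative_along_hray:
  fixes f :: "'n::finite lorentz \<Rightarrow> real"
  assumes \<kappa>: "\<kappa> > 0" and p: "p \<in> hyp \<kappa>" and u: "u \<in> tangent p" "lor u u = 1"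
    and f: "f differentiable_on hyp \<kappa>"
  shows "((\<lambda>s. f (hray \<kappa> p u s)) has_real_derivative
      lor (hgrad \<kappa> f (hray \<kappa> p u s)) (hray' \<kappa> p u s)) (at s)"
proof -
  have in_hyp: "hray \<kappa> p u t \<in> hyp \<kappa>" for t by (rule hray_in_hyp[OF \<kappa> p u])
  obtain D where D: "(f has_derivative D) (at (hray \<kappa> p u s) within hyp \<kappa>)"
    using f in_hyp unfolding differentiable_on_def differentiable_def by blast
  interpret D: linear D using D by (rule has_derivative_linear)
  \<comment> \<open>The derivative within \<open>hyp \<kappa>\<close> is restricted to the image of
    the geodesic, the form that the chain rule takes.\<close>
  have "(f has_derivative D) (at (hray \<kappa> p u s) within range (hray \<kappa> p u))"
    using D by (rule has_derivative_subset) (use in_hyp in auto)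
  moreover have "(hray \<kappa> p u has_derivative (\<lambda>t. t *\<^sub>R hray' \<kappa> p u s)) (at s within UNIV)"
    using hray_has_vector_derivative[OF \<kappa>] by (simp add: has_vector_derivative_def)
  ultimately have "((\<lambda>s. f (hray \<kappa> p u s)) has_derivative (\<lambda>t. D (t *\<^sub>R hray' \<kappa> p u s))) (at s)"
    using has_derivative_in_compose by fastforce
  moreover have "D (t *\<^sub>R hray' \<kappa> p u s)
      = lor (hgrad \<kappa> f (hray \<kappa> p u s)) (hray' \<kappa> p u s) * t" for t
    using hgrad(2)[OF \<kappa> in_hyp D hray'_tangent[OF \<kappa> p u]] by (simp add: D.scale)
  ultimately show ?thesis by (simp add: has_field_derivative_def)
qed

lemma hgrad_tangent:
  assumes "\<kappa> > 0" "p \<in> hyp \<kappa>" "f differentiable_on hyp \<kappa>"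
  shows "hgrad \<kappa> f p \<in> tangent p"
  using hgrad(1)[OF assms(1,2)] assms(2,3) unfolding differentiable_on_def differentiable_def
  by blast

text \<open>Convexity keeps the whole segment in C, so the Lipschitz bound compares the gradient at
  p with that at each point of the segment. Monotonicity of an auxiliary function replaces
  integration.\<close>

lemma descent_lemma:
  fixes f :: "'n::finite lorentz \<Rightarrow> real"
  assumes \<kappa>: "\<kappa> > 0" and C: "hconvex \<kappa> C" and f: "f differentiable_on hyp \<kappa>"
    and lip: "hgrad_lipschitz_on \<kappa> L C f"
    and p: "p \<in> C" and u: "u \<in> tangent p" "lor u u = 1" and s: "s > 0"
    and q: "hray \<kappa> p u s \<in> C"
  shows "f (hray \<kappa> p u s) \<le> f p + s / sqrt \<kappa> * lor (hgrad \<kappa> f p) u + L / 2 * (s / sqrt \<kappa>)\<^sup>2"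
proof -
  define g where "g = lor (hgrad \<kappa> f p) u / sqrt \<kappa>"
  \<comment> \<open>f along the geodesic minus its expected linear and quadratic growth. The
    coefficient L / \<kappa> collects one factor 1 / \<open>sqrt \<kappa>\<close> from the distance
    and one from the speed.\<close>
  define \<psi> where "\<psi> t = f (hray \<kappa> p u t) - (g * t + L / \<kappa> / 2 * t\<^sup>2)" for t
  have ph: "p \<in> hyp \<kappa>" using p C by (auto simp: hconvex_def)
  have gp: "hgrad \<kappa> f p \<in> tangent p" by (rule hgrad_tangent[OF \<kappa> ph f])
  have "\<psi> s \<le> \<psi> 0"
  proof (rule DERIV_nonpos_imp_nonincreasing[where f = \<psi>])
    show "0 \<le> s" using s by simp
    fix t assume t: "0 \<le> t" "t \<le> s"
    define r where "r = hray \<kappa> p u t"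
    define e where "e = hray' \<kappa> p u t"
    have "hray \<kappa> p u (t / s * s) \<in> hsegment \<kappa> p (hray \<kappa> p u s)"
      by (rule hray_in_hsegment[OF \<kappa> ph u s]) (use s t in simp)
    then have rC: "r \<in> C" using C p q s by (auto simp: hconvex_def r_def)
    then have rh: "r \<in> hyp \<kappa>" using C by (auto simp: hconvex_def)
    have gr: "hgrad \<kappa> f r \<in> tangent r" by (rule hgrad_tangent[OF \<kappa> rh f])
    have e: "e \<in> tangent r" unfolding e_def r_def by (rule hray'_tangent[OF \<kappa> ph u])
    define d where "d = ptransport \<kappa> p r (hgrad \<kappa> f p) - hgrad \<kappa> f r"
    have d: "d \<in> tangent r"
      unfolding d_def by (intro tangent_diff ptransport_tangent \<kappa> ph rh gr)
    have ne: "lnorm e = 1 / sqrt \<kappa>" unfolding e_def by (rule lnorm_hray'[OF \<kappa> ph u])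
    have "lnorm d \<le> L * (t / sqrt \<kappa>)"
      using lip p rC hdist_hray[OF \<kappa> ph u(1) t(1)]
      unfolding hgrad_lipschitz_on_def d_def r_def by metis
    \<comment> \<open>The gradient at r is the transported gradient minus d. The transported part
      pairs with the velocity to the constant g, so only the term with d has to be
      estimated.\<close>
    have "lor (hgrad \<kappa> f r) e = g + lor d (- e)"
      using lor_ptransport_hray'[OF \<kappa> ph u gp, of t]
      by (simp add: d_def lor_bilinear g_def r_def e_def)
    also have "lor d (- e) \<le> lnorm d * lnorm e"
      using lor_le_lnorm_mult[OF \<kappa> rh d tangent_scale[OF e, of "- 1"]] lnorm_scale[of "- 1" e]
      by simp
    also have "\<dots> \<le> L * (t / sqrt \<kappa>) * (1 / sqrt \<kappa>)"
      unfolding ne using \<open>lnorm d \<le> _\<close> \<kappa> by (intro mult_right_mono) auto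
    also have "\<dots> = L / \<kappa> * t" using \<kappa> by simp
    finally have le: "lor (hgrad \<kappa> f r) e \<le> g + L / \<kappa> * t" by simp
    have "(\<psi> has_real_derivative lor (hgrad \<kappa> f r) e - (g + L / \<kappa> * t)) (at t)"
      unfolding \<psi>_def r_def e_def
      using \<kappa>
      by (auto intro!: derivative_eq_intros has_derivative_along_hray[OF \<kappa> ph u f])
    with le show "\<exists>y. (\<psi> has_real_derivative y) (at t) \<and> y \<le> 0" by force
  qed
  moreover have "hray \<kappa> p u 0 = p" by (simp add: hray_def)
  ultimately show ?thesis
    using \<kappa> by (simp add: \<psi>_def g_def power_divide mult_ac)
qed

section \<open>One-step decrease and telescoping\<close>

theorem theorem19:
  fixes \<kappa> L \<alpha> \<Gamma> f_star :: real
    and C :: "'n::finite lorentz set"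
    and f :: "'n lorentz \<Rightarrow> real"
    and p :: "nat \<Rightarrow> 'n lorentz"
    and N :: nat
  assumes "\<kappa> > 0"
    and "closedin (top_of_set (hyp \<kappa>)) C"
    and "hconvex \<kappa> C"
    and "f differentiable_on hyp \<kappa>"
    and "{q \<in> C. \<forall>r\<in>C. f q \<le> f r} \<noteq> {}"
    and "bdd_below (f ` C)"
    and "f_star = (INF q\<in>C. f q)"
    and "L \<ge> 0"
    and "hgrad_lipschitz_on \<kappa> L C f"
    and "0 < \<alpha>"
    and "L > 0 \<longrightarrow> \<alpha> < 1 / L"
    and "\<Gamma> = (1 - \<alpha> * L) / (2 * \<alpha>)"
    and "p 0 \<in> C"
    and "\<And>k. p (Suc k) = hproj \<kappa> C (hexp \<kappa> (p k) (- (\<alpha> *\<^sub>R hgrad \<kappa> f (p k))))"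
    and "\<And>k. hgrad \<kappa> f (p k) \<noteq> 0"
  shows "Min ((\<lambda>k. hdist \<kappa> (p k) (p (Suc k))) ` {0..N})
           \<le> sqrt (f (p 0) - f_star) / sqrt (\<Gamma> * (real N + 1))"
proof -
  have \<kappa>: "\<kappa> > 0" and C: "hconvex \<kappa> C" and f: "f differentiable_on hyp \<kappa>" and \<alpha>: "\<alpha> > 0"
    by fact+
  have cl: "closed C"
    using assms(2) closed_hyp[OF \<kappa>] closedin_closed_trans by blast
  have sub: "C \<subseteq> hyp \<kappa>" using C by (simp add: hconvex_def)
  have ne: "C \<noteq> {}" using assms(13) by blast
  \<comment> \<open>The case L = 0 realizes the convention 1 / L = + infinity.\<close>
  have "\<alpha> * L < 1" using assms(8,10,11) by (cases "L = 0") (auto simp: field_simps)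
  then have \<Gamma>: "\<Gamma> > 0" using \<alpha> assms(12) by simp
  define v where "v k = - (\<alpha> *\<^sub>R hgrad \<kappa> f (p k))" for k
  have p_Suc: "p (Suc k) = hproj \<kappa> C (hexp \<kappa> (p k) (v k))" for k
    unfolding v_def by (rule assms(14))
  have v_tangent: "v k \<in> tangent (p k)" if "p k \<in> C" for k
    using tangent_scale[OF hgrad_tangent[OF \<kappa> _ f], of "p k" "- \<alpha>"] that sub
    by (auto simp: v_def)
  have hexp: "hexp \<kappa> (p k) (v k) \<in> hyp \<kappa>" if "p k \<in> C" for k
    using hexp_in_hyp[OF \<kappa> _ v_tangent[OF that]] that sub by blast
  have pC: "p k \<in> C" for k
  proof (induction k)
    case 0
    show ?case by (rule assms(13))
  next
    case (Suc k)
    then show ?case unfolding p_Suc by (intro hproj(1)[OF \<kappa> cl C ne] hexp)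
  qed
  then have ph: "p k \<in> hyp \<kappa>" for k using sub by blast
  define d where "d k = hdist \<kappa> (p k) (p (Suc k))" for k
  have d0: "d k \<ge> 0" for k unfolding d_def by (rule hdist_nonneg[OF \<kappa> ph ph])
  have step: "\<Gamma> * (d k)\<^sup>2 \<le> f (p k) - f (p (Suc k))" for k
  \<comment> \<open>Polar coordinates require distinct points; for equal ones both sides
    vanish.\<close>
  proof (cases "p k = p (Suc k)")
    case True
    then show ?thesis using hdist_self[OF \<kappa> ph[of k]] by (simp add: d_def)
  next
    case False
    obtain u s where u: "u \<in> tangent (p k)" "lor u u = 1" and s: "s > 0"
      and q: "p (Suc k) = hray \<kappa> (p k) u s"
      using hyp_polar[OF \<kappa> ph ph False] by blast
    have dk: "d k = s / sqrt \<kappa>"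
      unfolding d_def q using hdist_hray[OF \<kappa> ph u(1)] s by simp
    have "v k \<noteq> 0" using assms(15)[of k] \<alpha> by (simp add: v_def)
    moreover have "hdist \<kappa> (hexp \<kappa> (p k) (v k)) (hray \<kappa> (p k) u s)
        \<le> hdist \<kappa> (hexp \<kappa> (p k) (v k)) (p k)"
      using hproj(2)[OF \<kappa> cl C ne hexp[OF pC[of k]] pC[of k]] unfolding q[symmetric] p_Suc .
    ultimately have "d k \<le> 2 * lor (v k) u"
      using hproj_step[OF \<kappa> ph v_tangent[OF pC] _ u s] dk by simp
    then have "lor (hgrad \<kappa> f (p k)) u \<le> - (d k / (2 * \<alpha>))"
      using \<alpha> by (simp add: v_def lor_bilinear field_simps)
    from mult_left_mono[OF this d0[of k]]
    have "d k * lor (hgrad \<kappa> f (p k)) u \<le> - ((d k)\<^sup>2 / (2 * \<alpha>))"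
      by (simp add: power2_eq_square)
    moreover have "f (p (Suc k)) \<le> f (p k) + d k * lor (hgrad \<kappa> f (p k)) u + L / 2 * (d k)\<^sup>2"
      unfolding dk q using pC[of "Suc k"] unfolding q
      by (intro descent_lemma[OF \<kappa> C f assms(9) pC u s])
    \<comment> \<open>\<Gamma> = 1 / (2 * \<alpha>) - L / 2 is the gain from the projection minus
      the quadratic loss in the descent inequality.\<close>
    moreover have "\<Gamma> * (d k)\<^sup>2 = (d k)\<^sup>2 / (2 * \<alpha>) - L / 2 * (d k)\<^sup>2"
      using \<alpha> by (simp add: assms(12) field_simps)
    ultimately show ?thesis by linarith
  qed
  define m where "m = Min (d ` {0..N})"
  have m0: "m \<ge> 0" unfolding m_def using d0 by (subst Min_ge_iff) auto
  have "\<Gamma> * m\<^sup>2 \<le> f (p k) - f (p (Suc k))" if "k < Suc N" for k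
  proof -
    have "m \<le> d k" unfolding m_def using that by (intro Min_le) auto
    then have "\<Gamma> * m\<^sup>2 \<le> \<Gamma> * (d k)\<^sup>2" using m0 \<Gamma> by (intro mult_left_mono power_mono) auto
    also note step
    finally show ?thesis .
  qed
  \<comment> \<open>The indices 0, ..., N contribute N + 1 equal terms on the left, while the right
    side telescopes to \<open>p (Suc N)\<close>, whose value is at least
    \<open>f_star\<close>.\<close>
  then have "(\<Sum>k<Suc N. \<Gamma> * m\<^sup>2) \<le> (\<Sum>k<Suc N. f (p k) - f (p (Suc k)))"
    by (intro sum_mono) simp
  also have "\<dots> = f (p 0) - f (p (Suc N))" by (rule sum_lessThan_telescope')
  also have "\<dots> \<le> f (p 0) - f_star"
    using cINF_lower[OF assms(6) pC[of "Suc N"]] assms(7) by simp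
  finally have "m\<^sup>2 * (\<Gamma> * (real N + 1)) \<le> f (p 0) - f_star"
    by (simp add: algebra_simps)
  then have "m\<^sup>2 \<le> (f (p 0) - f_star) / (\<Gamma> * (real N + 1))"
    using \<Gamma> by (simp add: pos_le_divide_eq)
  then have "m \<le> sqrt ((f (p 0) - f_star) / (\<Gamma> * (real N + 1)))" by (rule real_le_rsqrt)
  then show ?thesis by (simp add: m_def d_def[abs_def] real_sqrt_divide)
qed

end
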